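(* Let $H$ be a graph with $h$ vertices, and let $n,s,k$ be nonnegative integers with $0\leq s\leq n$. Then $\alpha_k(K_n\cup H)=0$ if $k<\max(n,\chi(H))$ or $k>n+h$, and for $\max(n,\chi(H))\leq k\leq n+h$, \[ \alpha_k(K_n\cup H)=\sum_{j=\max(n-s,\chi(H))}^{k}\binom{s}{k-j}(j+s-n)_{s+j-k}\,\alpha_j(K_{n-s}\cup H). \] In particular, for $s=n$, \[ \alpha_k(K_n\cup H)=\sum_{j=\chi(H)}^{k}\binom{n}{k-j}(j)_{n+j-k}\,\alpha_j(H), \] and, for $s=1$, \[ \alpha_k(K_n\cup H)=(k-n+1)\,\alpha_k(K_{n-1}\cup H)+\alpha_{k-1}(K_{n-1}\cup H),\qquad n\geq 1. \]
   Context: All graphs are finite and simple. For a graph $G=(V,E)$ and an integer $k\ge 0$, $\alpha_k(G)$ denotes the number of partitions of $V$ into $k$ nonempty independent sets (so $\alpha_k(G)=0$ for $k$ outside $[\chi(G),|V|]$), where $\chi(G)$ is the chromatic number. $K_n$ ($n\ge1$) is the complete graph on $n$ vertices and $K_0$ is the graph with no vertices. For graphs on disjoint vertex sets, $G_1\cup G_2$ is their disjoint union. $(x)_m=x(x-1)\cdots(x-m+1)$ for $m\ge1$ and $(x)_0=1$; a summand whose binomial coefficient $\binom{s}{k-j}$ vanishes (i.e. $k-j>s$) is taken to be $0$. *)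

theory Defs
  imports "Graph_Theory.Graph_Theory" "HOL-Library.Disjoint_Sets"
begin

text \<open>
  A finite simple graph is a \<open>pair_graph\<close>: a finite, loop-free, symmetric digraph
  whose arcs are pairs of vertices, an edge \<open>uv\<close> being the two arcs \<open>(u,v)\<close> and \<open>(v,u)\<close>.
\<close>

definition independent :: "'a pair_pre_digraph \<Rightarrow> 'a set \<Rightarrow> bool" where
  "independent G S \<longleftrightarrow> S \<subseteq> pverts G \<and> (\<forall>u\<in>S. \<forall>v\<in>S. (u, v) \<notin> parcs G)"

definition alpha :: "nat \<Rightarrow> 'a pair_pre_digraph \<Rightarrow> nat" where
  "alpha k G = card {P. partition_on (pverts G) P \<and> card P = k \<and> (\<forall>S\<in>P. independent G S)}"

definition proper_colouring :: "'a pair_pre_digraph \<Rightarrow> nat \<Rightarrow> ('a \<Rightarrow> nat) \<Rightarrow> bool" where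
  "proper_colouring G k c \<longleftrightarrow>
     (\<forall>v\<in>pverts G. c v < k) \<and> (\<forall>(u, v)\<in>parcs G. c u \<noteq> c v)"

definition chromatic_number :: "'a pair_pre_digraph \<Rightarrow> nat" where
  "chromatic_number G = (LEAST k. \<exists>c. proper_colouring G k c)"

definition complete_graph :: "nat \<Rightarrow> nat pair_pre_digraph" where
  "complete_graph n =
     \<lparr> pverts = {..<n}, parcs = {(u, v). u < n \<and> v < n \<and> u \<noteq> v} \<rparr>"

text \<open>The summands are made disjoint by tagging their vertices with \<open>Inl\<close> and \<open>Inr\<close>.\<close>

definition disjoint_union ::
  "'a pair_pre_digraph \<Rightarrow> 'b pair_pre_digraph \<Rightarrow> ('a + 'b) pair_pre_digraph" where
  "disjoint_union G H =
     \<lparr> pverts = pverts G <+> pverts H,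
       parcs = map_prod Inl Inl ` parcs G \<union> map_prod Inr Inr ` parcs H \<rparr>"

definition falling_factorial :: "'a::comm_ring_1 \<Rightarrow> nat \<Rightarrow> 'a" where
  "falling_factorial x m = (\<Prod>i<m. x - of_nat i)"

lemma pair_graph_complete_graph: "pair_graph (complete_graph n)"
proof -
  have "finite {(u, v). u < n \<and> v < n \<and> u \<noteq> v}"
    by (rule finite_subset[of _ "{..<n} \<times> {..<n}"]) auto
  then show ?thesis
    by unfold_locales
      (auto simp: complete_graph_def symmetric_def sym_def)
qed

lemma pair_graph_disjoint_union:
  assumes "pair_graph G" "pair_graph H"
  shows "pair_graph (disjoint_union G H)"
proof -
  interpret G: pair_graph G by fact
  interpret H: pair_graph H by fact
  have s: "sym (parcs G)" "sym (parcs H)"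
    using G.sym_arcs H.sym_arcs by (auto simp: symmetric_def)
  let ?U = "disjoint_union G H"
  show ?thesis
  proof unfold_locales
    show "fst e \<in> pverts ?U" "snd e \<in> pverts ?U" if "e \<in> parcs ?U" for e
      using that by (auto simp: disjoint_union_def dest: G.wellformed' H.wellformed')
    show "finite (pverts ?U)" "finite (parcs ?U)"
      by (simp_all add: disjoint_union_def G.pair_finite_verts H.pair_finite_verts
          G.pair_finite_arcs H.pair_finite_arcs)
    show "fst e \<noteq> snd e" if "e \<in> parcs ?U" for e
      using that G.pair_no_loops H.pair_no_loops by (fastforce simp: disjoint_union_def)
    have "sym (parcs ?U)"
      using s by (intro symI) (force simp: disjoint_union_def image_iff dest: symD)
    then show "symmetric ?U"
      by (simp add: symmetric_def)
  qed
qed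

lemma proper_colouring_chromatic_number:
  assumes "pair_graph G"
  shows "\<exists>c. proper_colouring G (chromatic_number G) c"
proof -
  interpret pair_graph G by fact
  obtain c where c: "bij_betw c (pverts G) {0..<card (pverts G)}"
    using ex_bij_betw_finite_nat[OF pair_finite_verts] by blast
  have "c u \<noteq> c v" if "(u, v) \<in> parcs G" for u v
    using that c wellformed' pair_no_loops[OF that]
    by (auto simp: bij_betw_def inj_on_def)
  then have "proper_colouring G (card (pverts G)) c"
    using c by (auto simp: proper_colouring_def bij_betw_def)
  then show ?thesis
    unfolding chromatic_number_def by (intro LeastI) blast
qed

end

theory Submission
  imports Defs
begin

text \<open>
  Removing the last vertex \<open>v\<close> of the clique from a partition of \<open>K\<^sub>n\<^sub>+\<^sub>1 \<union> H\<close> either removes a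
  singleton block or leaves a partition with the same number of blocks. In the latter case
  \<open>v\<close> can be put back into every block except the \<open>n\<close> blocks meeting \<open>K\<^sub>n\<close>. This gives the
  recurrence for \<open>s = 1\<close>; the general formula is its solution by induction on \<open>s\<close>.
\<close>

section \<open>Partitions with a condition on the blocks\<close>

definition partitions_into :: "('a set \<Rightarrow> bool) \<Rightarrow> nat \<Rightarrow> 'a set \<Rightarrow> 'a set set set" where
  "partitions_into I k V = {P. partition_on V P \<and> card P = k \<and> (\<forall>S\<in>P. I S)}"

lemma finite_partitions_into: "finite V \<Longrightarrow> finite (partitions_into I k V)"
  unfolding partitions_into_def
  by (rule finite_subset[OF _ finitely_many_partition_on]) auto

lemma alpha_eq_card_partitions_into:
  "alpha k G = card (partitions_into (independent G) k (pverts G))"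
  by (simp add: alpha_def partitions_into_def)

text \<open>Blocks are subsets of \<open>V\<close>, so only the values of the predicate on such
  subsets matter. The predicate is kept abstract so that partitions of \<open>V\<close> and of
  \<open>insert v V\<close> can be counted with one and the same condition, independence in the
  larger graph; this lemma then replaces it on \<open>V\<close> by independence in the smaller
  graph.\<close>

lemma partitions_into_cong:
  assumes "\<And>S. S \<subseteq> V \<Longrightarrow> I S = J S"
  shows "partitions_into I k V = partitions_into J k V"
proof -
  have "S \<subseteq> V" if "partition_on V P" "S \<in> P" for P S
    using that by (auto simp: partition_on_def)
  then show ?thesis
    using assms by (auto simp: partitions_into_def)
qed

section \<open>Adding one point to the ground set\<close>

lemma partition_on_remove_point:
  assumes P: "partition_on (insert v V) P" and v: "v \<notin> V"
    and S: "S \<in> P" "v \<in> S" "S \<noteq> {v}"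
  shows "partition_on V (insert (S - {v}) (P - {S}))" and "S - {v} \<notin> P - {S}"
proof -
  have disj: "T \<inter> U = {}" if "T \<in> P" "U \<in> P" "T \<noteq> U" for T U
    using P that by (auto simp: partition_on_def disjoint_def)
  have un: "\<Union>P = insert v V" and ne: "{} \<notin> P"
    using P by (auto simp: partition_on_def)
  have vT: "v \<notin> T" if "T \<in> P - {S}" for T
    using disj[of T S] that S by auto
  show "partition_on V (insert (S - {v}) (P - {S}))"
  proof (rule partition_onI)
    have "\<Union>(insert (S - {v}) (P - {S})) = \<Union>P - {v}"
      using vT S(1) by blast
    then show "\<Union>(insert (S - {v}) (P - {S})) = V"
      using un v by auto
    show "{} \<notin> insert (S - {v}) (P - {S})"
      using ne S by auto
    show "disjnt T U" if "T \<in> insert (S - {v}) (P - {S})" "U \<in> insert (S - {v}) (P - {S})" "T \<noteq> U" for T U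
      unfolding disjnt_def using that disj[of T U] disj[of S U] disj[of T S] S(1) by auto
  qed
  \<comment> \<open>A nonempty subset of \<open>S\<close> cannot be another block, so shrinking
    \<open>S\<close> leaves the number of blocks unchanged.\<close>
  show "S - {v} \<notin> P - {S}"
    using disj[of "S - {v}" S] S by auto
qed

lemma partition_on_insert_point:
  assumes Q: "partition_on V Q" and v: "v \<notin> V" and T: "T \<in> Q"
  shows "partition_on (insert v V) (insert (insert v T) (Q - {T}))"
proof (rule partition_onI)
  have disj: "T \<inter> U = {}" if "T \<in> Q" "U \<in> Q" "T \<noteq> U" for T U
    using Q that by (auto simp: partition_on_def disjoint_def)
  have un: "\<Union>Q = V" and ne: "{} \<notin> Q"
    using Q by (auto simp: partition_on_def)
  show "\<Union>(insert (insert v T) (Q - {T})) = insert v V"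
    using un T by blast
  show "{} \<notin> insert (insert v T) (Q - {T})"
    using ne by auto
  have vU: "v \<notin> U" if "U \<in> Q" for U
    using un v that by blast
  show "disjnt U W" if "U \<in> insert (insert v T) (Q - {T})" "W \<in> insert (insert v T) (Q - {T})" "U \<noteq> W" for U W
    unfolding disjnt_def using that disj[of U W] disj[of T W] disj[of U T] T vU[of U] vU[of W] by auto
qed

text \<open>Adding and deleting the block \<open>{v}\<close> are mutually inverse;
  \<open>I {v}\<close> makes the added block admissible.\<close>

lemma card_partitions_into_singleton_block:
  assumes "finite V" and v: "v \<notin> V" and "I {v}"
  shows "card {P \<in> partitions_into I (Suc k) (insert v V). {v} \<in> P} =
    card (partitions_into I k V)"
proof (rule sym, rule bij_betw_same_card[of "insert {v}"],
    rule bij_betw_byWitness[where f' = "\<lambda>P. P - {{v}}"])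
  have nv: "{v} \<notin> Q" if "Q \<in> partitions_into I k V" for Q
    using that v by (auto simp: partitions_into_def partition_on_def)
  show "\<forall>Q\<in>partitions_into I k V. insert {v} Q - {{v}} = Q"
    using nv by auto
  show "\<forall>P\<in>{P \<in> partitions_into I (Suc k) (insert v V). {v} \<in> P}. insert {v} (P - {{v}}) = P"
    by auto
  show "insert {v} ` partitions_into I k V \<subseteq> {P \<in> partitions_into I (Suc k) (insert v V). {v} \<in> P}"
  proof (rule image_subsetI)
    fix Q assume Q: "Q \<in> partitions_into I k V"
    then have Q': "partition_on V Q"
      by (simp add: partitions_into_def)
    then have "partition_on (insert v V) (insert {v} Q)"
      using v by (auto simp: partition_on_def disjoint_def)
    moreover have "card (insert {v} Q) = Suc k"
      using nv[OF Q] Q finite_elements[OF \<open>finite V\<close> Q'] by (simp add: partitions_into_def)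
    ultimately show "insert {v} Q \<in> {P \<in> partitions_into I (Suc k) (insert v V). {v} \<in> P}"
      using Q \<open>I {v}\<close> by (auto simp: partitions_into_def)
  qed
  show "(\<lambda>P. P - {{v}}) ` {P \<in> partitions_into I (Suc k) (insert v V). {v} \<in> P} \<subseteq> partitions_into I k V"
  proof (rule image_subsetI)
    fix P assume P: "P \<in> {P \<in> partitions_into I (Suc k) (insert v V). {v} \<in> P}"
    then have P': "partition_on (insert v V) P" "{v} \<in> P" "card P = Suc k"
      by (auto simp: partitions_into_def)
    have "\<Union>(P - {{v}}) = V"
    proof -
      have "v \<notin> S" if "S \<in> P - {{v}}" for S
        using disjointD[OF partition_onD2[OF P'(1)], of S "{v}"] P'(2) that by auto
      then have "\<Union>(P - {{v}}) = \<Union>P - {v}" by blast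
      then show ?thesis
        using P' v by (auto simp: partition_on_def)
    qed
    then have "partition_on V (P - {{v}})"
      using P' by (auto simp: partition_on_def disjoint_def)
    then show "P - {{v}} \<in> partitions_into I k V"
      using P P' by (auto simp: partitions_into_def)
  qed
qed

text \<open>Deleting \<open>v\<close> from its block is a bijection onto the pairs of a partition
  \<open>Q\<close> of \<open>V\<close> and a block \<open>T\<close> of \<open>Q\<close> that can
  receive \<open>v\<close>. The assumption \<open>mono\<close> keeps the shortened block admissible.
  Counting the pairs over each \<open>Q\<close> gives the sum.\<close>

lemma card_partitions_into_larger_block:
  assumes fin: "finite V" and v: "v \<notin> V" and mono: "\<And>T. T \<subseteq> V \<Longrightarrow> I (insert v T) \<Longrightarrow> I T"
  shows "card {P \<in> partitions_into I k (insert v V). {v} \<notin> P} =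
    (\<Sum>Q\<in>partitions_into I k V. card {T \<in> Q. I (insert v T)})"
proof -
  let ?A = "SIGMA Q:partitions_into I k V. {T \<in> Q. I (insert v T)}"
  let ?B = "{P \<in> partitions_into I k (insert v V). {v} \<notin> P}"
  define f where "f = (\<lambda>(Q, T). insert (insert v T) (Q - {T}))"
  have finQ: "finite Q" if "Q \<in> partitions_into I k V" for Q
    using that finite_elements[OF fin] by (auto simp: partitions_into_def)
  have vU: "v \<notin> U" if "Q \<in> partitions_into I k V" "U \<in> Q" for Q U
    using that v by (auto simp: partitions_into_def partition_on_def)
  have "inj_on f ?A"
  proof (rule inj_onI, clarify)
    fix Q T Q' T'
    assume Q: "Q \<in> partitions_into I k V" "T \<in> Q" and Q': "Q' \<in> partitions_into I k V" "T' \<in> Q'"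
      and eq: "f (Q, T) = f (Q', T')"
    note nv = vU[OF Q(1)] vU[OF Q'(1)]
    \<comment> \<open>No block of \<open>Q'\<close> contains \<open>v\<close>, so the image reveals
      the enlarged block as the only one containing \<open>v\<close>. This determines
      \<open>T\<close>, and then the remaining blocks determine \<open>Q\<close>.\<close>
    have "insert v T \<in> f (Q', T')"
      unfolding eq[symmetric] by (simp add: f_def)
    then have "insert v T = insert v T' \<or> insert v T \<in> Q'"
      by (auto simp only: f_def prod.case insert_iff Diff_iff)
    then have "insert v T = insert v T'"
      using nv(2) by blast
    then have T: "T = T'"
      using nv(1)[OF Q(2)] nv(2)[OF Q'(2)] by (metis insert_ident)
    have "insert v T \<notin> Q - {T}" "insert v T' \<notin> Q' - {T'}"
      using nv by blast+
    then have "Q - {T} = f (Q, T) - {insert v T}" "Q' - {T'} = f (Q', T') - {insert v T'}"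
      by (simp_all add: f_def)
    then have "Q - {T} = Q' - {T'}"
      using eq T by simp
    then show "Q = Q' \<and> T = T'"
      using T Q(2) Q'(2) by blast
  qed
  moreover have "f ` ?A = ?B"
  proof (rule set_eqI, rule iffI)
    fix P assume "P \<in> f ` ?A"
    then obtain Q T where Q: "Q \<in> partitions_into I k V" "T \<in> Q" "I (insert v T)"
      and P: "P = insert (insert v T) (Q - {T})"
      by (auto simp: f_def)
    have Q': "partition_on V Q" "card Q = k"
      using Q by (auto simp: partitions_into_def)
    have "insert v T \<notin> Q - {T}"
      using vU[OF Q(1)] by auto
    then have "card P = k"
      using finQ[OF Q(1)] Q(2) Q'(2) card_Suc_Diff1[of Q T] by (simp add: P)
    moreover have "{v} \<notin> P"
    proof -
      have "T \<noteq> {}" using Q'(1) Q(2) by (auto simp: partition_on_def)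
      then show ?thesis
        using vU[OF Q(1)] Q(2) P by auto
    qed
    ultimately show "P \<in> ?B"
      using Q partition_on_insert_point[OF Q'(1) v Q(2)] by (auto simp: P partitions_into_def)
  next
    fix P assume "P \<in> ?B"
    then have P: "partition_on (insert v V) P" "card P = k" "\<And>S. S \<in> P \<Longrightarrow> I S" "{v} \<notin> P"
      by (auto simp: partitions_into_def)
    obtain S where S: "S \<in> P" "v \<in> S"
      using P(1) by (auto simp: partition_on_def)
    have Sv: "S \<noteq> {v}" using S P(4) by auto
    \<comment> \<open>The preimage of \<open>P\<close> is this partition with the marked block
      \<open>S - {v}\<close>, where \<open>S\<close> is the block of \<open>P\<close> containing
      \<open>v\<close>.\<close>
    let ?Q = "insert (S - {v}) (P - {S})"
    note Q = partition_on_remove_point[OF P(1) v S Sv]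
    have finP: "finite P"
      using finite_elements[OF _ P(1)] fin by simp
    have ins: "insert v (S - {v}) = S"
      using S by auto
    have "S \<subseteq> insert v V"
      using P(1) S by (auto simp: partition_on_def)
    then have IS: "I (S - {v})"
      using mono[of "S - {v}"] P(3)[OF S(1)] ins by auto
    have "card ?Q = k"
      using Q(2) finP S(1) P(2) card_Suc_Diff1[of P S] by simp
    then have "?Q \<in> partitions_into I k V"
      using Q(1) P(3) IS by (auto simp: partitions_into_def)
    then have "(?Q, S - {v}) \<in> ?A"
      using P(3)[OF S(1)] ins by auto
    moreover have "f (?Q, S - {v}) = P"
      using Q(2) S(1) ins by (auto simp: f_def)
    ultimately show "P \<in> f ` ?A"
      by (rule rev_image_eqI[OF _ sym])
  qed
  ultimately have "card ?B = card ?A"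
    using card_image[of f ?A] by simp
  also have "\<dots> = (\<Sum>Q\<in>partitions_into I k V. card {T \<in> Q. I (insert v T)})"
    using finite_partitions_into[OF fin] finQ by (intro card_SigmaI) auto
  finally show ?thesis .
qed

text \<open>Either \<open>v\<close> is a block by itself, and deleting it loses one block, or
  \<open>v\<close> joins a block of a partition of \<open>V\<close> that already has
  \<open>Suc k\<close> blocks.\<close>

lemma card_partitions_into_insert:
  assumes "finite V" "v \<notin> V" "I {v}" "\<And>T. T \<subseteq> V \<Longrightarrow> I (insert v T) \<Longrightarrow> I T"
  shows "card (partitions_into I (Suc k) (insert v V)) =
    card (partitions_into I k V) +
    (\<Sum>Q\<in>partitions_into I (Suc k) V. card {T \<in> Q. I (insert v T)})"
proof -
  let ?P = "partitions_into I (Suc k) (insert v V)"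
  have "finite ?P"
    using assms(1) by (simp add: finite_partitions_into)
  then have "card ?P = card {P \<in> ?P. {v} \<in> P} + card {P \<in> ?P. {v} \<notin> P}"
    by (subst card_Un_disjoint[symmetric]) (auto intro: arg_cong[where f = card])
  then show ?thesis
    using card_partitions_into_singleton_block[of V v I k]
      card_partitions_into_larger_block[of V v I "Suc k"] assms by simp
qed

section \<open>Invariance of \<open>alpha\<close> under relabelling\<close>

lemma alpha_inj_image:
  assumes f: "inj f"
  shows "alpha k \<lparr>pverts = f ` pverts G, parcs = map_prod f f ` parcs G\<rparr> = alpha k G"
proof -
  let ?G = "\<lparr>pverts = f ` pverts G, parcs = map_prod f f ` parcs G\<rparr>"
  let ?A = "partitions_into (independent G) k (pverts G)"
  let ?B = "partitions_into (independent ?G) k (pverts ?G)"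
  have "(f u, f v) \<in> map_prod f f ` parcs G \<longleftrightarrow> (u, v) \<in> parcs G" for u v
    using inj_image_mem_iff[OF prod.inj_map[OF f f], of "(u, v)"] by simp
  then have ind: "independent ?G (f ` S) \<longleftrightarrow> independent G S" for S
    using f by (simp add: independent_def inj_image_subset_iff)
  have inj: "inj ((`) f)"
    using f by (simp add: inj_on_image)
  have "(`) ((`) f) ` ?A = ?B"
  proof (rule set_eqI, rule iffI)
    fix P assume "P \<in> (`) ((`) f) ` ?A"
    then obtain Q where Q: "Q \<in> ?A" and P: "P = (`) f ` Q" by auto
    have Q': "partition_on (pverts G) Q"
      using Q by (simp add: partitions_into_def)
    \<comment> \<open>Images of nonempty blocks are nonempty, so discarding the empty set from the
      image partition changes nothing.\<close>
    then have "(`) f ` Q - {{}} = (`) f ` Q"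
      by (auto simp: partition_on_def)
    then have "partition_on (f ` pverts G) ((`) f ` Q)"
      using partition_on_inj_image[OF Q', of f] f by (simp add: inj_on_subset)
    moreover have "card ((`) f ` Q) = k"
      using Q inj by (simp add: partitions_into_def card_image inj_on_subset)
    ultimately show "P \<in> ?B"
      using Q ind by (auto simp: P partitions_into_def)
  next
    fix P assume P: "P \<in> ?B"
    \<comment> \<open>Surjectivity: blocks are pulled back along \<open>f\<close>. They lie in the
      range of \<open>f\<close>, so taking images undoes the preimages.\<close>
    let ?Q = "(-`) f ` P"
    have im: "f ` (f -` S) = S" if "S \<in> P" for S
    proof -
      have "S \<subseteq> f ` pverts G"
        using P that unfolding partitions_into_def partition_on_def by auto
      then show ?thesis by blast
    qed
    have eq: "(`) f ` ?Q = P"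
      using im by (force simp: image_image)
    have "\<Union>P = f ` pverts G"
      using P by (simp add: partitions_into_def partition_on_def)
    then have "\<Union>?Q = pverts G"
      using f by (metis inj_vimage_image_eq vimage_Union)
    moreover have "{} \<notin> ?Q"
    proof
      assume "{} \<in> ?Q"
      then obtain S where "S \<in> P" "f -` S = {}" by auto
      then have "{} \<in> P" using im[of S] by simp
      then show False using P by (simp add: partitions_into_def partition_on_def)
    qed
    moreover have "disjoint ?Q"
    proof (rule disjointI)
      fix A B assume "A \<in> ?Q" "B \<in> ?Q" "A \<noteq> B"
      then obtain S T where "S \<in> P" "T \<in> P" "S \<noteq> T" "A = f -` S" "B = f -` T" by auto
      moreover have "disjoint P"
        using P by (simp add: partitions_into_def partition_on_def)
      ultimately show "A \<inter> B = {}"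
        using disjointD[of P S T] by auto
    qed
    moreover have "card ?Q = k"
      using card_image[OF inj_on_subset[OF inj subset_UNIV], of ?Q] eq P
      by (simp add: partitions_into_def)
    moreover have "independent G S" if "S \<in> ?Q" for S
      using that P im ind[of S] by (auto simp: partitions_into_def)
    ultimately have "?Q \<in> ?A"
      by (auto simp: partitions_into_def partition_on_def)
    then show "P \<in> (`) ((`) f) ` ?A"
      using eq by (metis image_eqI)
  qed
  moreover have "inj_on ((`) ((`) f)) ?A"
    using inj by (meson inj_on_image inj_on_subset subset_UNIV)
  ultimately show ?thesis
    unfolding alpha_eq_card_partitions_into by (metis card_image)
qed

text \<open>Needed for the case \<open>s = n\<close>: with an empty clique only the copy of
  \<open>H\<close> tagged by \<open>Inr\<close> remains.\<close>

lemma alpha_complete_graph_0_union: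
  "alpha k (disjoint_union (complete_graph 0) H) = alpha k H"
proof -
  have "disjoint_union (complete_graph 0) H =
      \<lparr>pverts = Inr ` pverts H, parcs = map_prod Inr Inr ` parcs H\<rparr>"
    by (auto simp: disjoint_union_def complete_graph_def)
  then show ?thesis
    using alpha_inj_image[of "Inr :: 'a \<Rightarrow> nat + 'a"] by simp
qed

section \<open>Colourings and the range where \<open>alpha\<close> vanishes\<close>

lemma ex_proper_colouring_if_partition:
  assumes "finite (pverts G)" "fst ` parcs G \<subseteq> pverts G" "snd ` parcs G \<subseteq> pverts G"
    and "P \<in> partitions_into (independent G) k (pverts G)"
  shows "\<exists>c. proper_colouring G k c"
proof -
  have P: "partition_on (pverts G) P" "card P = k" "\<And>S. S \<in> P \<Longrightarrow> independent G S"
    using assms(4) by (auto simp: partitions_into_def)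
  \<comment> \<open>The blocks are numbered from \<open>0\<close> to \<open>k - 1\<close>; each
    vertex will be coloured by the number of its block.\<close>
  obtain b where b: "bij_betw b P {0..<card P}"
    using ex_bij_betw_finite_nat[OF finite_elements[OF assms(1) P(1)]] by blast
  have "\<forall>v\<in>pverts G. \<exists>S\<in>P. v \<in> S"
    using P(1) by (auto simp: partition_on_def)
  then obtain B where B: "\<And>v. v \<in> pverts G \<Longrightarrow> B v \<in> P \<and> v \<in> B v"
    by metis
  have "b (B u) \<noteq> b (B v)" if "(u, v) \<in> parcs G" for u v
  proof
    assume eq: "b (B u) = b (B v)"
    have uv: "u \<in> pverts G" "v \<in> pverts G"
      using that assms(2,3) by force+
    then have "B u = B v"
      using eq b B by (auto simp: bij_betw_def inj_on_def)
    then show False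
      using P(3)[of "B u"] B[OF uv(1)] B[OF uv(2)] that by (auto simp: independent_def)
  qed
  moreover have "b (B v) < k" if "v \<in> pverts G" for v
    using B[OF that] b P(2) by (auto simp: bij_betw_def)
  ultimately show ?thesis
    by (auto simp: proper_colouring_def intro!: exI[of _ "\<lambda>v. b (B v)"])
qed

lemma finite_complete_union:
  "pair_graph H \<Longrightarrow> finite (pverts (disjoint_union (complete_graph n) H))"
proof -
  assume "pair_graph H"
  then interpret pair_graph "disjoint_union (complete_graph n) H"
    by (intro pair_graph_disjoint_union pair_graph_complete_graph)
  show ?thesis by (rule pair_finite_verts)
qed

text \<open>A partition into \<open>k\<close> independent sets yields a proper
  \<open>k\<close>-colouring. It is injective on the clique and restricts to a colouring of
  \<open>H\<close>, which gives the lower bounds. Choosing a representative in each block gives the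
  upper bound.\<close>

lemma alpha_complete_union_bounds:
  assumes H: "pair_graph H" and "alpha k (disjoint_union (complete_graph n) H) \<noteq> 0"
  shows "max n (chromatic_number H) \<le> k" and "k \<le> n + card (pverts H)"
proof -
  let ?G = "disjoint_union (complete_graph n) H"
  have "pair_graph ?G"
    using H by (simp add: pair_graph_disjoint_union pair_graph_complete_graph)
  then interpret G: pair_graph ?G .
  interpret H: pair_graph H by fact
  obtain P where P: "P \<in> partitions_into (independent ?G) k (pverts ?G)"
    using assms(2) unfolding alpha_eq_card_partitions_into by fastforce
  obtain c where c: "proper_colouring ?G k c"
    using ex_proper_colouring_if_partition[OF G.pair_finite_verts _ _ P] G.wellformed' by force
  have "inj_on (c \<circ> Inl) {..<n}"
    using c by (intro inj_onI)
      (force simp: proper_colouring_def disjoint_union_def complete_graph_def)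
  moreover have "(c \<circ> Inl) ` {..<n} \<subseteq> {..<k}"
    using c by (auto simp: proper_colouring_def disjoint_union_def complete_graph_def)
  ultimately have "n \<le> k"
    using card_inj_on_le[of "c \<circ> Inl" "{..<n}" "{..<k}"] by simp
  moreover have "proper_colouring H k (c \<circ> Inr)"
    using c by (force simp: proper_colouring_def disjoint_union_def)
  then have "chromatic_number H \<le> k"
    unfolding chromatic_number_def by (intro Least_le) blast
  ultimately show "max n (chromatic_number H) \<le> k" by simp
  have "card P \<le> card (pverts ?G)"
  proof -
    have part: "partition_on (pverts ?G) P"
      using P by (simp add: partitions_into_def)
    have "\<forall>S\<in>P. \<exists>x. x \<in> S" using part by (metis all_not_in_conv partition_on_def)
    then obtain r where r: "\<And>S. S \<in> P \<Longrightarrow> r S \<in> S" by metis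
    have "inj_on r P"
      using r disjointD[OF partition_onD2[OF part]] by (metis disjoint_iff inj_onI)
    moreover have "r ` P \<subseteq> pverts ?G"
      using r part by (auto simp: partition_on_def)
    ultimately show ?thesis
      using card_inj_on_le G.pair_finite_verts by blast
  qed
  also have "card (pverts ?G) = n + card (pverts H)"
    using H.pair_finite_verts by (simp add: disjoint_union_def complete_graph_def card_Plus)
  finally show "k \<le> n + card (pverts H)"
    using P by (simp add: partitions_into_def)
qed

section \<open>The recurrence for one more clique vertex\<close>

lemma card_blocks_avoiding_clique:
  assumes H: "pair_graph H"
    and Q: "Q \<in> partitions_into (independent (disjoint_union (complete_graph n) H)) k
      (pverts (disjoint_union (complete_graph n) H))"
  shows "int (card {T \<in> Q. T \<inter> Inl ` {..<n} = {}}) = int k - int n"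
proof -
  let ?G = "disjoint_union (complete_graph n) H"
  have Q': "partition_on (pverts ?G) Q" "card Q = k" "\<And>T. T \<in> Q \<Longrightarrow> independent ?G T"
    using Q by (auto simp: partitions_into_def)
  have fin: "finite Q"
    using finite_elements[OF finite_complete_union[OF H] Q'(1)] .
  \<comment> \<open>The block \<open>B i\<close> of the clique vertex \<open>i\<close> depends
    injectively on \<open>i\<close>, since adjacent vertices cannot share an independent block.
    Hence exactly \<open>n\<close> blocks meet the clique.\<close>
  have "\<forall>i\<in>{..<n}. \<exists>T\<in>Q. Inl i \<in> T"
    using Q'(1) by (auto simp: partition_on_def disjoint_union_def complete_graph_def)
  then obtain B where B: "\<And>i. i < n \<Longrightarrow> B i \<in> Q \<and> Inl i \<in> B i"
    by (metis lessThan_iff)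
  have "inj_on B {..<n}"
  proof (rule inj_onI, rule ccontr)
    fix i j assume ij: "i \<in> {..<n}" "j \<in> {..<n}" "B i = B j" "i \<noteq> j"
    then have "(Inl i, Inl j) \<in> parcs ?G"
      by (force simp: disjoint_union_def complete_graph_def)
    then show False
      using Q'(3)[of "B i"] B[of i] B[of j] ij by (auto simp: independent_def)
  qed
  then have "card (B ` {..<n}) = n"
    by (simp add: card_image)
  moreover have "{T \<in> Q. T \<inter> Inl ` {..<n} = {}} = Q - B ` {..<n}"
  proof -
    have "T = B i" if "T \<in> Q" "i < n" "Inl i \<in> T" for T i
      using that B[of i] Q'(1) by (auto simp: partition_on_def disjoint_def)
    then show ?thesis
      using B by blast
  qed
  moreover have sub: "B ` {..<n} \<subseteq> Q"
    using B by auto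
  \<comment> \<open>The \<open>n\<close> blocks \<open>B i\<close> are among the \<open>k\<close>
    blocks of \<open>Q\<close>, so \<open>n \<le> k\<close> and natural subtraction agrees with the
    integer difference.\<close>
  ultimately show ?thesis
    using card_Diff_subset[OF _ sub] card_mono[OF fin sub] Q'(2) by simp
qed

text \<open>The new vertex \<open>Inl n\<close> is adjacent exactly to the old clique vertices, so a
  block can receive it iff it avoids the clique. Every partition into \<open>Suc k\<close> blocks
  therefore contributes the same number to the sum. If \<open>Suc k < n\<close>, the factor is
  negative, but there are no such partitions.\<close>

lemma alpha_complete_union_rec:
  assumes H: "pair_graph H"
  shows "int (alpha (Suc k) (disjoint_union (complete_graph (Suc n)) H)) =
    (int (Suc k) - int n) * int (alpha (Suc k) (disjoint_union (complete_graph n) H)) +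
    int (alpha k (disjoint_union (complete_graph n) H))"
proof -
  let ?G = "disjoint_union (complete_graph n) H"
  let ?G' = "disjoint_union (complete_graph (Suc n)) H"
  let ?V = "pverts ?G"
  let ?I = "independent ?G'"
  have V': "pverts ?G' = insert (Inl n) ?V"
    by (auto simp: disjoint_union_def complete_graph_def less_Suc_eq)
  have v: "Inl n \<notin> ?V"
    by (auto simp: disjoint_union_def complete_graph_def)
  have arcs: "parcs ?G' = parcs ?G \<union> {Inl n} \<times> Inl ` {..<n} \<union> Inl ` {..<n} \<times> {Inl n}"
    by (auto simp: disjoint_union_def complete_graph_def less_Suc_eq image_iff)
  have no: "(Inl n, x) \<notin> parcs ?G" "(x, Inl n) \<notin> parcs ?G" for x
    by (auto simp: disjoint_union_def complete_graph_def)
  have I: "?I S = independent ?G S" if "S \<subseteq> ?V" for S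
    using that v unfolding independent_def V' arcs by auto
  have Iv: "?I (insert (Inl n) T) \<longleftrightarrow> independent ?G T \<and> T \<inter> Inl ` {..<n} = {}"
    if "T \<subseteq> ?V" for T
    using that v no unfolding independent_def V' arcs by auto
  have parts: "partitions_into ?I j ?V = partitions_into (independent ?G) j ?V" for j
    by (rule partitions_into_cong) (rule I)
  have "?I {Inl n}"
    using Iv[of "{}"] by (simp add: independent_def)
  moreover have "?I T" if "T \<subseteq> ?V" "?I (insert (Inl n) T)" for T
    using that I Iv by simp
  ultimately have "alpha (Suc k) ?G' = alpha k ?G +
      (\<Sum>Q\<in>partitions_into (independent ?G) (Suc k) ?V. card {T \<in> Q. ?I (insert (Inl n) T)})"
    using card_partitions_into_insert[OF finite_complete_union[OF H] v, of ?I k]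
    unfolding alpha_eq_card_partitions_into V' parts by blast
  moreover have "int (card {T \<in> Q. ?I (insert (Inl n) T)}) = int (Suc k) - int n"
    if Q: "Q \<in> partitions_into (independent ?G) (Suc k) ?V" for Q
  proof -
    have "{T \<in> Q. ?I (insert (Inl n) T)} = {T \<in> Q. T \<inter> Inl ` {..<n} = {}}"
      using Q by (intro Collect_cong conj_cong refl, subst Iv)
        (auto simp: partitions_into_def partition_on_def)
    then show ?thesis
      using card_blocks_avoiding_clique[OF H Q] by simp
  qed
  ultimately show ?thesis
    by (simp add: alpha_eq_card_partitions_into[of "Suc k" ?G])
qed

section \<open>Solving the recurrence\<close>

lemma falling_factorial_Suc:
  "falling_factorial x (Suc m) = falling_factorial x m * (x - of_nat m)"
  by (simp add: falling_factorial_def)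

text \<open>Pascal's rule combined with splitting off the last factor of the falling factorial. This
  is the recurrence for the coefficient of the initial value with index \<open>j\<close>.\<close>

lemma binomial_falling_factorial_rec:
  fixes j k m s :: nat
  assumes "j \<le> k"
  shows "int (Suc s choose (Suc k - j)) * falling_factorial (int j - int m) (Suc s + j - Suc k) =
    (int (Suc k) - int (m + s)) *
      (int (s choose (Suc k - j)) * falling_factorial (int j - int m) (s + j - Suc k)) +
    int (s choose (k - j)) * falling_factorial (int j - int m) (s + j - k)"
proof -
  obtain i where k: "k = j + i"
    using assms by (metis le_add_diff_inverse)
  show ?thesis
  proof (cases "i < s")
    case True
    then obtain t where s: "s = Suc (i + t)"
      using less_imp_Suc_add by blast
    \<comment> \<open>\<open>d\<close> is both the last factor of the falling factorial of length
      \<open>Suc t\<close> and the multiplier \<open>int (Suc k) - int (m + s)\<close> of the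
      recurrence.\<close>
    define d where "d = int j - int m - int t"
    have "falling_factorial (int j - int m) (Suc t) = falling_factorial (int j - int m) t * d"
      by (simp add: falling_factorial_Suc d_def)
    then have "int (Suc s choose Suc i) * falling_factorial (int j - int m) (Suc t) =
        d * (int (s choose Suc i) * falling_factorial (int j - int m) t) +
        int (s choose i) * falling_factorial (int j - int m) (Suc t)"
      by (simp add: algebra_simps)
    moreover have "int (Suc k) - int (m + s) = d" "Suc k - j = Suc i" "k - j = i"
      "Suc s + j - Suc k = Suc t" "s + j - Suc k = t" "s + j - k = Suc t"
      by (simp_all add: k s d_def)
    ultimately show ?thesis
      by (simp only:)
  next
    case False
    \<comment> \<open>Here \<open>i \<ge> s\<close>, so \<open>s choose Suc i\<close> is
      \<open>0\<close> and all three falling factorials have length \<open>0\<close> by truncated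
      subtraction; Pascal's rule gives the rest.\<close>
    then show ?thesis
      by (simp add: k Suc_diff_le binomial_eq_0)
  qed
qed

text \<open>The recurrence is linear, so in the induction on \<open>s\<close> it suffices to compare
  the coefficients of each \<open>f 0 j\<close>. In the application \<open>m\<close> is the size of
  the initial clique and \<open>s\<close> the number of vertices added to it.\<close>

lemma triangular_recurrence_solution:
  fixes f :: "nat \<Rightarrow> nat \<Rightarrow> int"
  assumes rec: "\<And>s k. f (Suc s) (Suc k) = (int (Suc k) - int (m + s)) * f s (Suc k) + f s k"
    and f_Suc_0: "\<And>s. f (Suc s) 0 = 0"
    and f_0_less: "\<And>j. j < m \<Longrightarrow> f 0 j = 0"
  shows "f s k = (\<Sum>j\<le>k. int (s choose (k - j)) *
    falling_factorial (int j - int m) (s + j - k) * f 0 j)"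
proof (induction s arbitrary: k)
  case 0
  have "(\<Sum>j\<le>k. int (0 choose (k - j)) * falling_factorial (int j - int m) (0 + j - k) * f 0 j) =
      (\<Sum>j\<le>k. if j = k then f 0 j else 0)"
    by (rule sum.cong) (auto simp: falling_factorial_def binomial_eq_0)
  then show ?case by simp
next
  case (Suc s)
  show ?case
  proof (cases k)
    case 0
    \<comment> \<open>For \<open>m = 0\<close> the first factor of the falling factorial is
      \<open>0\<close>; for \<open>m > 0\<close> the initial value \<open>f 0 0\<close> is
      \<open>0\<close>.\<close>
    have "falling_factorial (- int m) (Suc s) * f 0 0 = 0"
      using f_0_less[of 0] by (cases "m = 0") (auto simp: falling_factorial_def)
    then show ?thesis
      using 0 f_Suc_0 by simp
  next
    case (Suc k')
    let ?t = "\<lambda>s k j. int (s choose (k - j)) * falling_factorial (int j - int m) (s + j - k)"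
    let ?c = "int (Suc k') - int (m + s)"
    have step: "?t (Suc s) (Suc k') j * f 0 j =
        ?c * (?t s (Suc k') j * f 0 j) + ?t s k' j * f 0 j" if "j \<le> k'" for j
      unfolding binomial_falling_factorial_rec[OF that, of s m] by (simp only: algebra_simps)
    \<comment> \<open>The index \<open>Suc k'\<close> is absent from the sum up to
      \<open>k'\<close>. Both binomials are \<open>1\<close> here, and the extra factor of the
      longer falling factorial is \<open>?c\<close>.\<close>
    have last: "?t (Suc s) (Suc k') (Suc k') * f 0 (Suc k') =
        ?c * (?t s (Suc k') (Suc k') * f 0 (Suc k'))"
      by (simp add: falling_factorial_Suc algebra_simps)
    have "(\<Sum>j\<le>Suc k'. ?t (Suc s) (Suc k') j * f 0 j) =
        ?c * (\<Sum>j\<le>Suc k'. ?t s (Suc k') j * f 0 j) + (\<Sum>j\<le>k'. ?t s k' j * f 0 j)"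
    proof -
      have "(\<Sum>j\<le>k'. ?t (Suc s) (Suc k') j * f 0 j) =
          (\<Sum>j\<le>k'. ?c * (?t s (Suc k') j * f 0 j) + ?t s k' j * f 0 j)"
        by (rule sum.cong[OF refl]) (simp only: atMost_iff step)
      then show ?thesis
        unfolding sum.atMost_Suc last distrib_left sum_distrib_left sum.distrib by linarith
    qed
    then show ?thesis
      by (simp only: Suc rec Suc.IH)
  qed
qed

lemma alpha_complete_union_expansion:
  assumes H: "pair_graph H" and "s \<le> n"
  shows "int (alpha k (disjoint_union (complete_graph n) H)) =
    (\<Sum>j = max (n - s) (chromatic_number H)..k.
       int (s choose (k - j)) *
       falling_factorial (int j + int s - int n) (s + j - k) *
       int (alpha j (disjoint_union (complete_graph (n - s)) H)))"
proof -
  let ?m = "n - s"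
  let ?A = "\<lambda>n k. int (alpha k (disjoint_union (complete_graph n) H))"
  \<comment> \<open>This supplies the boundary values of the recurrence and later removes the
    summands below the stated lower limit.\<close>
  have zero: "?A n k = 0" if "k < max n (chromatic_number H)" for n k
    using alpha_complete_union_bounds(1)[OF H, of k n] that by linarith
  have "?A (?m + s) k = (\<Sum>j\<le>k. int (s choose (k - j)) *
      falling_factorial (int j - int ?m) (s + j - k) * ?A (?m + 0) j)"
    using alpha_complete_union_rec[OF H] zero
    by (intro triangular_recurrence_solution[where f = "\<lambda>s. ?A (?m + s)"]) auto
  also have "\<dots> = (\<Sum>j = max ?m (chromatic_number H)..k. int (s choose (k - j)) *
      falling_factorial (int j - int ?m) (s + j - k) * ?A ?m j)"
    using zero[of _ ?m] by (intro sum.mono_neutral_cong_right) auto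
  finally show ?thesis
    using \<open>s \<le> n\<close> by (simp add: algebra_simps)
qed

theorem theorem2:
  fixes H :: "'a pair_pre_digraph" and h n s k :: nat
  assumes "pair_graph H"
    and "card (pverts H) = h"
    and "s \<le> n"
  shows
    "(k < max n (chromatic_number H) \<or> k > n + h \<longrightarrow>
        alpha k (disjoint_union (complete_graph n) H) = 0) \<and>
     (max n (chromatic_number H) \<le> k \<and> k \<le> n + h \<longrightarrow>
        int (alpha k (disjoint_union (complete_graph n) H)) =
          (\<Sum>j = max (n - s) (chromatic_number H)..k.
             int (s choose (k - j)) *
             falling_factorial (int j + int s - int n) (s + j - k) *
             int (alpha j (disjoint_union (complete_graph (n - s)) H))) \<and>
        int (alpha k (disjoint_union (complete_graph n) H)) =
          (\<Sum>j = chromatic_number H..k.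
             int (n choose (k - j)) *
             falling_factorial (int j) (n + j - k) *
             int (alpha j H)) \<and>
        (n \<ge> 1 \<longrightarrow>
           int (alpha k (disjoint_union (complete_graph n) H)) =
             (int k - int n + 1) * int (alpha k (disjoint_union (complete_graph (n - 1)) H)) +
             int (alpha (k - 1) (disjoint_union (complete_graph (n - 1)) H))))"
proof -
  let ?A = "\<lambda>n k. alpha k (disjoint_union (complete_graph n) H)"
  have "?A n k = 0" if "k < max n (chromatic_number H) \<or> k > n + h"
    using alpha_complete_union_bounds[OF assms(1), of k n] assms(2) that by linarith
  \<comment> \<open>The case \<open>s = n\<close>, where \<open>n - s = 0\<close> turns the lower
    limit into the chromatic number of \<open>H\<close>.\<close>
  moreover have "int (?A n k) = (\<Sum>j = chromatic_number H..k. int (n choose (k - j)) *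
      falling_factorial (int j) (n + j - k) * int (alpha j H))"
    using alpha_complete_union_expansion[OF assms(1) order.refl, of k n]
    by (simp add: alpha_complete_graph_0_union)
  \<comment> \<open>For \<open>s = 1\<close> the recurrence is used directly, shifted by one in both
    parameters; \<open>1 \<le> n \<le> k\<close> makes the subtractions exact.\<close>
  moreover have "int (?A n k) = (int k - int n + 1) * int (?A (n - 1) k) + int (?A (n - 1) (k - 1))"
    if "1 \<le> n" "n \<le> k"
    using alpha_complete_union_rec[OF assms(1), of "k - 1" "n - 1"] that
    by (simp add: algebra_simps)
  ultimately show ?thesis
    using alpha_complete_union_expansion[OF assms(1,3), of k] by auto
qed

end
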